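(* Let $V$ be an open subset of $\mathbb{R}^r$ and $B=[0,1]$. Let $s_F : V \to V$ be a $C^\infty$-map and $L_F := \mathrm{id}_{\mathbb{R}^r}$. Let $s_G : V\times\mathbb{R} \to V$ be a $C^\infty$-map such that $s_G(\cdot,0)=s_F$ and $s_G(\cdot,1)=\mathrm{id}_V$, and let $L_G=\mathrm{pr}_1 : \mathbb{R}^r\times\mathbb{R}\to\mathbb{R}^r$ be the projection to the first factor. Denote by $F^*$ (respectively $G^*$) the pullback of superforms from $V$ to $V$ (respectively from $V$ to $V\times\mathbb{R}$) via the pair $(s_F,L_F)$ (respectively $(s_G,L_G)$). Let $K'$ be any operator consisting of linear maps $K': A^{p,q}(V\times B)\to A^{p-1,q}(V)$ (for all $p,q$) satisfying $$d'K'+K'd'=\iota_1^*-\iota_0^*,$$ where $\iota_i: V\to V\times B$, $x\mapsto (x,i)$, for $i=0,1$. Then for every $\alpha\in A^{p,q}(V)$ we have $$\alpha-F^*\alpha = d'K'G^*\alpha+K'G^*d'\alpha ,$$ where $G^*\alpha$ and $G^*d'\alpha$ are restricted to $V\times B$ before applying $K'$.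
   Context: Superforms on open sets: for $U\subset\mathbb{R}^m$ open, $A^{p,q}(U):=A^p(U)\otimes_{\mathbb{R}}\Lambda^q(\mathbb{R}^m)^*$, where $A^p(U)$ is the space of smooth real differential $p$-forms on $U$; $A^{p,q}=0$ if $p<0$ or $q<0$. The operator $d':A^{p,q}(U)\to A^{p+1,q}(U)$ is $D\otimes\mathrm{id}$, with $D$ the exterior derivative. For $x\in U$ and $v_1,\dots,v_p,w_1,\dots,w_q\in\mathbb{R}^m$, write $\langle\beta(x);v_1,\dots,v_p,w_1,\dots,w_q\rangle$ for the evaluation of the $A^p$-factor at $x$ on the $v_i$ and of the $\Lambda^q$-factor on the $w_j$. Superforms on $V\times B$ (with $V \subset \mathbb{R}^r$ open, $B=[0,1]$): an element of $A^{p,q}(V\times B)$ is given by a superform on an open subset of $\mathbb{R}^r\times\mathbb{R}$ whose intersection with $\mathbb{R}^r \times B$ is $V\times B$; two such superforms define the same element if, at every point of $V\times B$, they take the same values on all tangent vectors $v_i,w_j$, and likewise their restrictions to the faces $V\times\{0\}$, $V\times\{1\}$ agree (on vectors tangent to these faces). The operator $d'$ is induced by the one on representatives. The pullback $\iota_i^*:A^{p,q}(V\times B)\to A^{p,q}(V)$ is the affine pullback: $\langle \iota_i^*\beta(x);v_1,\dots,v_p,w_1,\dots,w_q\rangle=\langle\beta(x,i);(v_1,0),\dots,(v_p,0),(w_1,0),\dots,(w_q,0)\rangle$. Pullback via pairs: for open sets $V'\subset\mathbb{R}^{r'}$, $V\subset\mathbb{R}^r$ and a pair $F=(s_F,L_F)$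 with $s_F:V'\to V$ a $C^\infty$-map and $L_F:\mathbb{R}^{r'}\to\mathbb{R}^r$ linear, $F^*:=s_F^*\otimes L_F^*:A^{p,q}(V)\to A^{p,q}(V')$, i.e. $$\langle F^*(\beta)(x);v_1,\dots,v_p,w_1,\dots,w_q\rangle=\langle\beta(s_F(x));d(s_F)_x(v_1),\dots,d(s_F)_x(v_p),L_F(w_1),\dots,L_F(w_q)\rangle .$$ *)

theory Defs
  imports "HOL-Analysis.Analysis" "HOL-Library.Function_Algebras"
begin

text \<open>
  Sums, differences and zero of (super)forms are those of functions
  (\<^theory>\<open>HOL-Library.Function_Algebras\<close>).  Degrees are integers, so that the spaces of
  negative degree are available; they are zero by definition of \<open>alt_forms\<close> below.
\<close>


section \<open>Smooth maps\<close>

fun times_diff_on :: "'a::real_normed_vector set \<Rightarrow> ('a \<Rightarrow> 'b::real_normed_vector) \<Rightarrow> nat \<Rightarrow> bool" where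
  "times_diff_on U f 0 \<longleftrightarrow> continuous_on U f"
| "times_diff_on U f (Suc n) \<longleftrightarrow>
     (\<forall>x\<in>U. f differentiable at x) \<and>
     (\<forall>v. times_diff_on U (\<lambda>x. frechet_derivative f (at x) v) n)"

text \<open>To be used for open \<open>U\<close> only, since the derivatives are taken at \<open>at x\<close>.\<close>

definition smooth_on :: "'a::real_normed_vector set \<Rightarrow> ('a \<Rightarrow> 'b::real_normed_vector) \<Rightarrow> bool" where
  "smooth_on U f \<longleftrightarrow> (\<forall>n. times_diff_on U f n)"


section \<open>Differential forms\<close>

text \<open>
  The space \<open>\<Lambda>\<^sup>p\<close> of the dual: alternating multilinear functions of \<open>p\<close> vectors.  The vectors are
  given as a list; the value on lists of any other length is \<open>0\<close>.
\<close>

definition alt_forms :: "int \<Rightarrow> ('a::real_vector list \<Rightarrow> real) set" where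
  "alt_forms p = {\<eta>.
     (\<forall>vs. int (length vs) \<noteq> p \<longrightarrow> \<eta> vs = 0) \<and>
     (\<forall>vs i. int (length vs) = p \<and> i < length vs \<longrightarrow> linear (\<lambda>v. \<eta> (vs[i := v]))) \<and>
     (\<forall>vs i j. int (length vs) = p \<and> i < j \<and> j < length vs \<and> vs ! i = vs ! j \<longrightarrow> \<eta> vs = 0)}"

text \<open>
  The space \<open>A\<^sup>p(U)\<close>.  A form on \<open>U\<close> is extended by \<open>0\<close> outside of \<open>U\<close>, so that equality of forms
  on \<open>U\<close> is equality of functions.
\<close>

definition diff_forms :: "int \<Rightarrow> 'a::euclidean_space set \<Rightarrow> ('a \<Rightarrow> 'a list \<Rightarrow> real) set" where
  "diff_forms p U = {\<omega>.
     (\<forall>x\<in>U. \<omega> x \<in> alt_forms p) \<and>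
     (\<forall>x. x \<notin> U \<longrightarrow> \<omega> x = 0) \<and>
     (\<forall>vs. smooth_on U (\<lambda>x. \<omega> x vs))}"

text \<open>
  The exterior derivative
  \<open>(D \<omega>)\<^sub>x (v\<^sub>0,\<dots>,v\<^sub>p) = (\<Sum>i. (-1)\<^sup>i * \<partial>\<^sub>v\<^sub>i \<omega>(v\<^sub>0,\<dots>,v\<^sub>i\<^sub>-\<^sub>1,v\<^sub>i\<^sub>+\<^sub>1,\<dots>,v\<^sub>p) (x))\<close>.
\<close>

definition ext_deriv ::
    "'a::euclidean_space set \<Rightarrow> ('a \<Rightarrow> 'a list \<Rightarrow> real) \<Rightarrow> 'a \<Rightarrow> 'a list \<Rightarrow> real" where
  "ext_deriv U \<omega> x vs =
     (if x \<in> U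
      then \<Sum>i<length vs. (-1) ^ i *
             frechet_derivative (\<lambda>y. \<omega> y (take i vs @ drop (Suc i) vs)) (at x) (vs ! i)
      else 0)"


section \<open>Superforms on open sets\<close>

text \<open>
  An element of \<open>A\<^sup>p(U) \<otimes> \<Lambda>\<^sup>q\<close> is represented by its evaluation
  \<open>\<langle>\<beta>(x); v\<^sub>1,\<dots>,v\<^sub>p, w\<^sub>1,\<dots>,w\<^sub>q\<rangle> = \<beta> x [v\<^sub>1,\<dots>,v\<^sub>p] [w\<^sub>1,\<dots>,w\<^sub>q]\<close>; the tensor product of two spaces of
  functions embeds into the functions on the product as the span of the products \<open>\<omega> \<otimes> \<eta>\<close>.
\<close>

type_synonym 'a superform = "'a \<Rightarrow> 'a list \<Rightarrow> 'a list \<Rightarrow> real"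

definition form_tensor ::
    "('a \<Rightarrow> 'a list \<Rightarrow> real) \<Rightarrow> ('a list \<Rightarrow> real) \<Rightarrow> 'a superform" where
  "form_tensor \<omega> \<eta> = (\<lambda>x vs ws. \<omega> x vs * \<eta> ws)"

definition superforms :: "int \<Rightarrow> int \<Rightarrow> 'a::euclidean_space set \<Rightarrow> 'a superform set" where
  "superforms p q U =
     {\<Sum>i<n. form_tensor (\<omega> i) (\<eta> i) | (n::nat) \<omega> \<eta>.
        \<forall>i<n. \<omega> i \<in> diff_forms p U \<and> \<eta> i \<in> alt_forms q}"

text \<open>
  The operator \<open>D \<otimes> id\<close>: apply \<open>D\<close> with the arguments of the second factor fixed; see
  \<open>d'_form_tensor\<close> and \<open>d'_sum_form_tensor\<close> below.
\<close>

definition d' :: "'a::euclidean_space set \<Rightarrow> 'a superform \<Rightarrow> 'a superform" where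
  "d' U \<beta> = (\<lambda>x vs ws. ext_deriv U (\<lambda>y us. \<beta> y us ws) x vs)"

text \<open>The pullback to \<open>V'\<close> via a pair \<open>(s, L)\<close> of a smooth map \<open>s\<close> on \<open>V'\<close> and a linear map \<open>L\<close>.\<close>

definition pullback ::
    "'a::euclidean_space set \<Rightarrow> ('a \<Rightarrow> 'b::euclidean_space) \<times> ('a \<Rightarrow> 'b) \<Rightarrow>
     'b superform \<Rightarrow> 'a superform" where
  "pullback V' = (\<lambda>(s, L) \<beta> x vs ws.
     if x \<in> V' then \<beta> (s x) (map (frechet_derivative s (at x)) vs) (map L ws) else 0)"


section \<open>Superforms on \<open>V \<times> [0,1]\<close>\<close>

definition slab :: "'a set \<Rightarrow> ('a \<times> real) set" where
  "slab V = V \<times> {0..1}"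

definition slab_nbhd :: "'a::euclidean_space set \<Rightarrow> ('a \<times> real) set \<Rightarrow> bool" where
  "slab_nbhd V W \<longleftrightarrow> open W \<and> W \<inter> (UNIV \<times> {0..1}) = slab V"

definition restrict_slab ::
    "'a set \<Rightarrow> ('a \<times> real) superform \<Rightarrow> ('a \<times> real) superform" where
  "restrict_slab V \<beta> = (\<lambda>z. if z \<in> slab V then \<beta> z else 0)"

text \<open>
  Two representatives define the same element of \<open>A\<^sup>p\<^sup>,\<^sup>q(V \<times> [0,1])\<close> iff they have the same values at
  the points of \<open>V \<times> [0,1]\<close> (this entails the agreement of their restrictions to the two faces), so
  the class of a representative is encoded by its restriction; see \<open>restrict_slab_eq_iff\<close>.
\<close>

definition slab_superforms ::
    "int \<Rightarrow> int \<Rightarrow> 'a::euclidean_space set \<Rightarrow> ('a \<times> real) superform set" where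
  "slab_superforms p q V =
     {restrict_slab V \<gamma> | \<gamma> W. slab_nbhd V W \<and> \<gamma> \<in> superforms p q W}"

text \<open>
  The operator \<open>d'\<close> on \<open>V \<times> [0,1]\<close>, induced by the one on representatives; see
  \<open>slab_d'_restrict_slab\<close> for independence of the representative.
\<close>

definition slab_d' ::
    "'a::euclidean_space set \<Rightarrow> ('a \<times> real) superform \<Rightarrow> ('a \<times> real) superform" where
  "slab_d' V \<beta> = (THE \<delta>. \<exists>p q W \<gamma>. slab_nbhd V W \<and> \<gamma> \<in> superforms p q W \<and>
      \<beta> = restrict_slab V \<gamma> \<and> \<delta> = restrict_slab V (d' W \<gamma>))"

text \<open>The affine pullback along \<open>x \<mapsto> (x, t)\<close>.\<close>

definition face_pullback ::
    "real \<Rightarrow> 'a::euclidean_space set \<Rightarrow> ('a \<times> real) superform \<Rightarrow> 'a superform" where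
  "face_pullback t V \<beta> = (\<lambda>x vs ws.
     if x \<in> V then \<beta> (x, t) (map (\<lambda>v. (v, 0)) vs) (map (\<lambda>w. (w, 0)) ws) else 0)"

definition linear_operator :: "'a superform set \<Rightarrow> 'b superform set \<Rightarrow>
    ('a superform \<Rightarrow> 'b superform) \<Rightarrow> bool" where
  "linear_operator A B T \<longleftrightarrow>
     (\<forall>\<beta>\<in>A. T \<beta> \<in> B) \<and>
     (\<forall>\<beta>\<in>A. \<forall>\<gamma>\<in>A. T (\<beta> + \<gamma>) = T \<beta> + T \<gamma>) \<and>
     (\<forall>c::real. \<forall>\<beta>\<in>A. T (\<lambda>x vs ws. c * \<beta> x vs ws) = (\<lambda>y vs ws. c * T \<beta> y vs ws))"


section \<open>The operators \<open>d'\<close> are well-behaved\<close>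

lemma sum_fun_apply: "(\<Sum>i\<in>I. f i) x = (\<Sum>i\<in>I. f i x)"
  by (induction I rule: infinite_finite_induct) auto

lemma smooth_on_differentiable: "smooth_on U f \<Longrightarrow> x \<in> U \<Longrightarrow> f differentiable at x"
  unfolding smooth_on_def by (metis times_diff_on.simps(2))

lemma smooth_on_continuous_deriv:
  "smooth_on U f \<Longrightarrow> continuous_on U (\<lambda>x. frechet_derivative f (at x) v)"
  unfolding smooth_on_def by (metis times_diff_on.simps)

lemma diff_forms_differentiable:
  "\<omega> \<in> diff_forms p U \<Longrightarrow> x \<in> U \<Longrightarrow> (\<lambda>y. \<omega> y vs) differentiable at x"
  by (auto simp: diff_forms_def intro: smooth_on_differentiable)

lemma frechet_derivative_sum_tensor:
  fixes \<omega> :: "nat \<Rightarrow> 'a::euclidean_space \<Rightarrow> 'a list \<Rightarrow> real"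
  assumes "\<forall>i<n. \<omega> i \<in> diff_forms p U" "x \<in> U"
  shows "((\<lambda>y. (\<Sum>i<n. form_tensor (\<omega> i) (\<eta> i)) y us ws) has_derivative
          (\<lambda>v. \<Sum>i<n. frechet_derivative (\<lambda>y. \<omega> i y us) (at x) v * \<eta> i ws)) (at x)"
proof -
  have "((\<lambda>y. \<Sum>i<n. \<omega> i y us * \<eta> i ws) has_derivative
          (\<lambda>v. \<Sum>i<n. frechet_derivative (\<lambda>y. \<omega> i y us) (at x) v * \<eta> i ws)) (at x)"
    using assms
    by (intro has_derivative_sum has_derivative_mult_left)
       (auto simp flip: frechet_derivative_works intro: diff_forms_differentiable)
  then show ?thesis
    by (simp add: sum_fun_apply form_tensor_def)
qed

lemma d'_sum_form_tensor:
  fixes n :: nat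
  assumes "\<forall>i<n. \<omega> i \<in> diff_forms p U"
  shows "d' U (\<Sum>i<n. form_tensor (\<omega> i) (\<eta> i)) = (\<Sum>i<n. form_tensor (ext_deriv U (\<omega> i)) (\<eta> i))"
proof (intro ext)
  fix x vs ws
  show "d' U (\<Sum>i<n. form_tensor (\<omega> i) (\<eta> i)) x vs ws
      = (\<Sum>i<n. form_tensor (ext_deriv U (\<omega> i)) (\<eta> i)) x vs ws"
  proof (cases "x \<in> U")
    case True
    note fd = frechet_derivative_at[OF frechet_derivative_sum_tensor[OF assms True], symmetric]
    show ?thesis
      unfolding d'_def ext_deriv_def fd
      using True
      by (simp add: sum_fun_apply form_tensor_def ext_deriv_def sum_distrib_left sum_distrib_right
            sum.swap[of _ "{..<n}"] mult.assoc)
  next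
    case False
    then show ?thesis
      by (simp add: d'_def ext_deriv_def sum_fun_apply form_tensor_def)
  qed
qed

lemma d'_form_tensor:
  assumes "\<omega> \<in> diff_forms p U"
  shows "d' U (form_tensor \<omega> \<eta>) = form_tensor (ext_deriv U \<omega>) \<eta>"
  using d'_sum_form_tensor[of "Suc 0" "\<lambda>_. \<omega>" p U "\<lambda>_. \<eta>"] assms
  by (simp add: lessThan_Suc del: sum_constant)

lemma restrict_slab_eq_iff:
  "restrict_slab V \<beta> = restrict_slab V \<gamma> \<longleftrightarrow> (\<forall>z\<in>slab V. \<forall>vs ws. \<beta> z vs ws = \<gamma> z vs ws)"
  by (auto simp: restrict_slab_def fun_eq_iff)

lemma superform_differentiable:
  assumes "\<beta> \<in> superforms p q U" "x \<in> U"
  shows "(\<lambda>y. \<beta> y us ws) differentiable at x"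
proof -
  obtain n :: nat and \<omega> \<eta> where "\<beta> = (\<Sum>i<n. form_tensor (\<omega> i) (\<eta> i))"
    and "\<forall>i<n. \<omega> i \<in> diff_forms p U"
    using assms(1) unfolding superforms_def by blast
  then show ?thesis
    using frechet_derivative_sum_tensor assms(2) unfolding differentiable_def by blast
qed

lemma superform_continuous_deriv:
  assumes "\<beta> \<in> superforms p q U"
  shows "continuous_on U (\<lambda>x. frechet_derivative (\<lambda>y. \<beta> y us ws) (at x) v)"
proof -
  obtain n :: nat and \<omega> \<eta> where \<beta>: "\<beta> = (\<Sum>i<n. form_tensor (\<omega> i) (\<eta> i))"
    and \<omega>: "\<forall>i<n. \<omega> i \<in> diff_forms p U"
    using assms unfolding superforms_def by blast
  have "continuous_on U (\<lambda>x. \<Sum>i<n. frechet_derivative (\<lambda>y. \<omega> i y us) (at x) v * \<eta> i ws)"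
    using \<omega> by (intro continuous_intros smooth_on_continuous_deriv) (auto simp: diff_forms_def)
  then show ?thesis
    by (rule continuous_on_eq)
       (simp add: \<beta> frechet_derivative_at[OF frechet_derivative_sum_tensor[OF \<omega>], symmetric])
qed

lemma restrict_slab_d'_cong:
  assumes V: "open V"
    and 1: "slab_nbhd V W1" "\<gamma>1 \<in> superforms p1 q1 W1"
    and 2: "slab_nbhd V W2" "\<gamma>2 \<in> superforms p2 q2 W2"
    and eq: "restrict_slab V \<gamma>1 = restrict_slab V \<gamma>2"
  shows "restrict_slab V (d' W1 \<gamma>1) = restrict_slab V (d' W2 \<gamma>2)"
proof -
  have sub: "slab V \<subseteq> W1" "slab V \<subseteq> W2"
    using 1 2 by (auto simp: slab_nbhd_def)
  have "frechet_derivative (\<lambda>y. \<gamma>1 y us ws) (at z) v = frechet_derivative (\<lambda>y. \<gamma>2 y us ws) (at z) v"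
    if z: "z \<in> slab V" for us ws v z
  proof -
    define f1 where "f1 = (\<lambda>y. \<gamma>1 y us ws)"
    define f2 where "f2 = (\<lambda>y. \<gamma>2 y us ws)"
    define g1 where "g1 = (\<lambda>y. frechet_derivative f1 (at y) v)"
    define g2 where "g2 = (\<lambda>y. frechet_derivative f2 (at y) v)"
    obtain x t where xt: "z = (x, t)" "x \<in> V" "0 \<le> t" "t \<le> 1"
      using z by (auto simp: slab_def)
    have feq: "f1 y = f2 y" if "y \<in> slab V" for y
      using eq that by (auto simp: restrict_slab_eq_iff f1_def f2_def)
    have interior: "g1 y = g2 y" if y: "y \<in> V \<times> {0<..<1}" for y
    proof -
      have "y \<in> slab V"
        using y by (auto simp: slab_def)
      then have "(f2 has_derivative frechet_derivative f2 (at y)) (at y)"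
        unfolding f2_def frechet_derivative_works[symmetric]
        using superform_differentiable[OF 2(2)] sub(2) by blast
      moreover have op: "open (V \<times> {0<..<1::real})"
        using V by (intro open_Times) auto
      ultimately have "(f1 has_derivative frechet_derivative f2 (at y)) (at y)"
        using has_derivative_transform_within_open[OF _ op y] feq by (force simp: slab_def)
      then show ?thesis
        unfolding g1_def g2_def by (simp flip: frechet_derivative_at)
    qed
    have cont: "continuous_on (slab V) g1" "continuous_on (slab V) g2"
      unfolding g1_def g2_def f1_def f2_def
      using continuous_on_subset[OF superform_continuous_deriv[OF 1(2)] sub(1)]
        continuous_on_subset[OF superform_continuous_deriv[OF 2(2)] sub(2)]
      by blast+
    have line: "continuous_on {0..1} (\<lambda>s. (x, s))" "(\<lambda>s. (x, s)) ` {0..1} \<subseteq> slab V"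
      using xt(2) by (auto simp: slab_def intro!: continuous_on_Pair continuous_on_const continuous_on_id)
    have "continuous_on {0..1} (\<lambda>s. g1 (x, s) - g2 (x, s))"
      by (intro continuous_on_diff continuous_on_compose2[OF cont(1) line]
          continuous_on_compose2[OF cont(2) line])
    moreover have cl: "closure {0<..<1} = {0..1::real}"
      by simp
    ultimately have "g1 (x, t) - g2 (x, t) = 0"
      using continuous_constant_on_closure[of "{0<..<1}" "\<lambda>s. g1 (x, s) - g2 (x, s)" 0 t]
        interior xt unfolding cl by simp
    then show ?thesis
      by (simp add: g1_def g2_def f1_def f2_def xt)
  qed
  then show ?thesis
    using sub by (auto simp: restrict_slab_eq_iff d'_def ext_deriv_def)
qed

lemma slab_d'_restrict_slab:
  assumes "open V" "slab_nbhd V W" "\<gamma> \<in> superforms p q W"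
  shows "slab_d' V (restrict_slab V \<gamma>) = restrict_slab V (d' W \<gamma>)"
  unfolding slab_d'_def
proof (rule the_equality)
  show "\<exists>p q W' \<gamma>'. slab_nbhd V W' \<and> \<gamma>' \<in> superforms p q W' \<and>
      restrict_slab V \<gamma> = restrict_slab V \<gamma>' \<and> restrict_slab V (d' W \<gamma>) = restrict_slab V (d' W' \<gamma>')"
    using assms(2,3) by blast
next
  fix \<delta>
  assume "\<exists>p q W' \<gamma>'. slab_nbhd V W' \<and> \<gamma>' \<in> superforms p q W' \<and>
      restrict_slab V \<gamma> = restrict_slab V \<gamma>' \<and> \<delta> = restrict_slab V (d' W' \<gamma>')"
  then show "\<delta> = restrict_slab V (d' W \<gamma>)"
    using restrict_slab_d'_cong[OF assms] by metis
qed

end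

theory Submission
  imports Defs
begin

text \<open>
  Pullback via a pair commutes with \<open>d'\<close>, so the homotopy formula for \<open>K'\<close>, applied to the
  restriction of \<open>G\<^sup>*\<alpha>\<close>, reads
  \<open>d'K'G\<^sup>*\<alpha> + K'G\<^sup>*d'\<alpha> = \<iota>\<^sub>1\<^sup>*G\<^sup>*\<alpha> - \<iota>\<^sub>0\<^sup>*G\<^sup>*\<alpha>\<close>; here \<open>G \<circ> \<iota>\<^sub>1\<close> is the identity pair and
  \<open>G \<circ> \<iota>\<^sub>0 = F\<close>.
\<close>

section \<open>Calculus of smooth maps\<close>

text \<open>The pair (s, L) acts on the two tensor factors by unrelated maps, ds on the first and L
  on the second. Since L does not vary with the point and D acts only on the first factor,
  commutation with \<open>d'\<close> reduces to the classical identity s^* D = D s^* for ordinary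
  forms; this is why \<open>id\<close> may accompany an s_F whose differential is something else.
  The obstacle is that \<open>smooth_on\<close> and \<open>diff_forms\<close> control derivatives
  and values along fixed vectors only, whereas a pullback inserts vectors ds_x(v) that move with x.
  Such vectors are therefore expanded in the standard basis, which moves the dependence on x into
  scalar coefficients. The boundary of the slab causes no trouble: V x R is open and meets R^r x
  [0,1] in V x [0,1], so \<open>G\<^sup>*\<alpha>\<close> is itself a representative of the slab
  superform to which K' is applied.\<close>

text \<open>On an open set, functions that agree have the same derivative at each point, so the
  agreement passes to all orders. This is needed because derivative formulas are available on U
  only.\<close>

lemma times_diff_on_cong:
  assumes "open U" "\<And>x. x \<in> U \<Longrightarrow> f x = g x" "times_diff_on U f n"
  shows "times_diff_on U g n"
  using assms(2,3)
proof (induction n arbitrary: f g)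
  case 0
  then show ?case
    by (simp cong: continuous_on_cong)
next
  case (Suc n)
  have fg: "(g has_derivative frechet_derivative f (at x)) (at x)" if "x \<in> U" for x
    using Suc.prems(2) that
    by (intro has_derivative_transform_within_open[OF _ \<open>open U\<close> that Suc.prems(1)])
       (auto simp flip: frechet_derivative_works)
  have "times_diff_on U (\<lambda>x. frechet_derivative g (at x) v) n" for v
    by (rule Suc.IH[of "\<lambda>x. frechet_derivative f (at x) v"])
       (use Suc.prems(2) in \<open>auto simp flip: frechet_derivative_at[OF fg]\<close>)
  with fg show ?case
    by (auto simp: differentiable_def)
qed

lemma times_diff_on_SucD: "times_diff_on U f (Suc n) \<Longrightarrow> times_diff_on U f n"
proof (induction n arbitrary: f)
  case 0
  then show ?case
    by (auto intro!: continuous_at_imp_continuous_on differentiable_imp_continuous_within)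
next
  case (Suc n)
  from Suc.prems Suc.IH show ?case
    by (metis times_diff_on.simps(2))
qed

lemma times_diff_on_const: "times_diff_on U (\<lambda>x. c) n"
proof (induction n arbitrary: c)
  case (Suc n)
  from Suc[of 0] show ?case
    by auto
qed auto

lemma times_diff_on_add:
  assumes "open U" "times_diff_on U f n" "times_diff_on U g n"
  shows "times_diff_on U (\<lambda>x. f x + g x) n"
  using assms(2,3)
proof (induction n arbitrary: f g)
  case 0
  then show ?case
    by (auto intro: continuous_on_add)
next
  case (Suc n)
  have der: "((\<lambda>x. f x + g x) has_derivative
      (\<lambda>v. frechet_derivative f (at x) v + frechet_derivative g (at x) v)) (at x)" if "x \<in> U" for x
    using Suc.prems that by (auto intro!: has_derivative_add simp flip: frechet_derivative_works)
  have "times_diff_on U (\<lambda>x. frechet_derivative (\<lambda>x. f x + g x) (at x) v) n" for v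
    by (rule times_diff_on_cong[OF \<open>open U\<close> _ Suc.IH[of "\<lambda>x. frechet_derivative f (at x) v"
          "\<lambda>x. frechet_derivative g (at x) v"]])
       (use Suc.prems in \<open>auto simp flip: frechet_derivative_at[OF der]\<close>)
  with der show ?case
    by (auto simp: differentiable_def)
qed

lemma times_diff_on_sum:
  assumes "open U" "\<And>i. i \<in> I \<Longrightarrow> times_diff_on U (f i) n"
  shows "times_diff_on U (\<lambda>x. \<Sum>i\<in>I. f i x) n"
  using assms(2)
  by (induction I rule: infinite_finite_induct)
     (auto intro: times_diff_on_const times_diff_on_add[OF \<open>open U\<close>])

text \<open>The derivative of B(f, g) is a sum of two terms of the same shape, each with one factor
  differentiated, so the induction runs over all f and g at once; the undifferentiated factor is
  lowered to order n by \<open>times_diff_on_SucD\<close>. One B covers product, inner product and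
  scaling.\<close>

lemma times_diff_on_bilinear:
  assumes "bounded_bilinear B" "open U" "times_diff_on U f n" "times_diff_on U g n"
  shows "times_diff_on U (\<lambda>x. B (f x) (g x)) n"
  using assms(3,4)
proof (induction n arbitrary: f g)
  case 0
  then show ?case
    using bounded_bilinear.continuous_on[OF assms(1)] by auto
next
  case (Suc n)
  have der: "((\<lambda>x. B (f x) (g x)) has_derivative
      (\<lambda>v. B (f x) (frechet_derivative g (at x) v) + B (frechet_derivative f (at x) v) (g x))) (at x)"
    if "x \<in> U" for x
    using Suc.prems that
    by (auto intro!: bounded_bilinear.FDERIV[OF assms(1)] simp flip: frechet_derivative_works)
  have "times_diff_on U (\<lambda>x. B (f x) (frechet_derivative g (at x) v)
      + B (frechet_derivative f (at x) v) (g x)) n" for v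
    using Suc.prems Suc.prems[THEN times_diff_on_SucD]
    by (intro times_diff_on_add[OF \<open>open U\<close>] Suc.IH) auto
  then have "times_diff_on U (\<lambda>x. frechet_derivative (\<lambda>x. B (f x) (g x)) (at x) v) n" for v
    by (rule times_diff_on_cong[OF \<open>open U\<close>, rotated]) (simp flip: frechet_derivative_at[OF der])
  with der show ?case
    by (auto simp: differentiable_def)
qed

lemma linear_euclidean_expansion:
  fixes f :: "'a::euclidean_space \<Rightarrow> 'b::real_vector"
  assumes "linear f"
  shows "f u = (\<Sum>b\<in>Basis. (u \<bullet> b) *\<^sub>R f b)"
proof -
  have "f u = f (\<Sum>b\<in>Basis. (u \<bullet> b) *\<^sub>R b)"
    by (simp add: euclidean_representation)
  then show ?thesis
    by (simp add: linear_sum[OF assms] linear_scale[OF assms])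
qed

text \<open>Chain rule in coordinates: the direction ds_x(v) varies with x, so it is expanded in the
  basis, leaving the partial derivatives of f along fixed b, composed with s. These have one order
  less, and the induction over all f applies to them.\<close>

lemma times_diff_on_compose:
  fixes s :: "'a::real_normed_vector \<Rightarrow> 'b::euclidean_space"
    and f :: "'b \<Rightarrow> 'c::real_normed_vector"
  assumes "open U" "s ` U \<subseteq> V" "times_diff_on V f n" "times_diff_on U s n"
  shows "times_diff_on U (\<lambda>x. f (s x)) n"
  using assms(3,4)
proof (induction n arbitrary: f)
  case 0
  then show ?case
    using continuous_on_compose2[of V f U s] assms(2) by auto
next
  case (Suc n)
  have der: "((\<lambda>x. f (s x)) has_derivative
      (\<lambda>v. frechet_derivative f (at (s x)) (frechet_derivative s (at x) v))) (at x)" if "x \<in> U" for x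
    using Suc.prems that assms(2) diff_chain_at[of s _ x f]
    by (auto simp: o_def simp flip: frechet_derivative_works)
  have "times_diff_on U (\<lambda>x. frechet_derivative s (at x) v \<bullet> b) n" for v b
    using Suc.prems
    by (intro times_diff_on_bilinear[OF bounded_bilinear_inner \<open>open U\<close>] times_diff_on_const) auto
  then have "times_diff_on U
      (\<lambda>x. \<Sum>b\<in>Basis. (frechet_derivative s (at x) v \<bullet> b) *\<^sub>R frechet_derivative f (at (s x)) b) n" for v
    using Suc.prems times_diff_on_SucD[OF Suc.prems(2)]
    by (intro times_diff_on_sum[OF \<open>open U\<close>]
        times_diff_on_bilinear[OF bounded_bilinear_scaleR \<open>open U\<close>] Suc.IH) auto
  then have "times_diff_on U (\<lambda>x. frechet_derivative (\<lambda>x. f (s x)) (at x) v) n" for v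
  proof (rule times_diff_on_cong[OF \<open>open U\<close>, rotated])
    fix x
    assume x: "x \<in> U"
    then have "linear (frechet_derivative f (at (s x)))"
      using Suc.prems(1) assms(2) by (auto intro: linear_frechet_derivative)
    then show "(\<Sum>b\<in>Basis. (frechet_derivative s (at x) v \<bullet> b) *\<^sub>R frechet_derivative f (at (s x)) b)
        = frechet_derivative (\<lambda>x. f (s x)) (at x) v"
      by (simp add: linear_euclidean_expansion[of _ "frechet_derivative s (at x) v"]
          flip: frechet_derivative_at[OF der[OF x]])
  qed
  with der show ?case
    by (auto simp: differentiable_def)
qed

lemma smooth_on_cong:
  "open U \<Longrightarrow> (\<And>x. x \<in> U \<Longrightarrow> f x = g x) \<Longrightarrow> smooth_on U f \<Longrightarrow> smooth_on U g"
  unfolding smooth_on_def using times_diff_on_cong by blast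

lemma smooth_on_sum:
  "open U \<Longrightarrow> (\<And>i. i \<in> I \<Longrightarrow> smooth_on U (f i)) \<Longrightarrow> smooth_on U (\<lambda>x. \<Sum>i\<in>I. f i x)"
  by (simp add: smooth_on_def times_diff_on_sum)

lemma smooth_on_mult:
  fixes f g :: "'a::real_normed_vector \<Rightarrow> real"
  shows "open U \<Longrightarrow> smooth_on U f \<Longrightarrow> smooth_on U g \<Longrightarrow> smooth_on U (\<lambda>x. f x * g x)"
  by (simp add: smooth_on_def times_diff_on_bilinear[OF bounded_bilinear_mult])

lemma smooth_on_inner_left:
  fixes f :: "'a::real_normed_vector \<Rightarrow> 'b::real_inner"
  shows "open U \<Longrightarrow> smooth_on U f \<Longrightarrow> smooth_on U (\<lambda>x. f x \<bullet> b)"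
  by (simp add: smooth_on_def times_diff_on_bilinear[OF bounded_bilinear_inner] times_diff_on_const)

lemma smooth_on_compose:
  fixes s :: "'a::real_normed_vector \<Rightarrow> 'b::euclidean_space"
  assumes "open U" "s ` U \<subseteq> V" "smooth_on V f" "smooth_on U s"
  shows "smooth_on U (\<lambda>x. f (s x))"
  using assms times_diff_on_compose unfolding smooth_on_def by blast

lemma smooth_on_frechet_derivative:
  "smooth_on U f \<Longrightarrow> smooth_on U (\<lambda>x. frechet_derivative f (at x) v)"
  unfolding smooth_on_def by (metis times_diff_on.simps(2))

section \<open>Symmetry of second derivatives\<close>

text \<open>Two applications of the mean value theorem, along v and then along w. The second
  difference is symmetric in v and w, while the right-hand side is a mixed derivative in a fixed
  order.\<close>

lemma mixed_second_difference:
  fixes f :: "'a::real_normed_vector \<Rightarrow> real"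
  assumes f: "\<And>y. y \<in> U \<Longrightarrow> f differentiable at y"
    and fv: "\<And>y. y \<in> U \<Longrightarrow> (\<lambda>z. frechet_derivative f (at z) v) differentiable at y"
    and "0 < h"
    and U: "\<And>a b. 0 \<le> a \<Longrightarrow> a \<le> h \<Longrightarrow> 0 \<le> b \<Longrightarrow> b \<le> h \<Longrightarrow> x + a *\<^sub>R v + b *\<^sub>R w \<in> U"
  obtains a b where "0 \<le> a" "a \<le> h" "0 \<le> b" "b \<le> h"
    "f (x + h *\<^sub>R v + h *\<^sub>R w) - f (x + h *\<^sub>R v) - f (x + h *\<^sub>R w) + f x =
       h\<^sup>2 * frechet_derivative (\<lambda>z. frechet_derivative f (at z) v) (at (x + a *\<^sub>R v + b *\<^sub>R w)) w"
proof -
  have lin: "((\<lambda>t. F (y + t *\<^sub>R u)) has_derivative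
      (\<lambda>r. r * frechet_derivative F (at (y + t *\<^sub>R u)) u)) (at t within T)"
    if "F differentiable at (y + t *\<^sub>R u)" for F :: "'a \<Rightarrow> real" and y u t T
  proof -
    have "((\<lambda>t. y + t *\<^sub>R u) has_derivative (\<lambda>r. r *\<^sub>R u)) (at t)"
      by (auto intro!: derivative_eq_intros)
    from diff_chain_at[OF this] that have "((\<lambda>t. F (y + t *\<^sub>R u)) has_derivative
        (\<lambda>r. frechet_derivative F (at (y + t *\<^sub>R u)) (r *\<^sub>R u))) (at t)"
      by (auto simp: o_def frechet_derivative_works)
    then show ?thesis
      using linear_scale[OF linear_frechet_derivative[OF that]] has_derivative_at_withinI by simp
  qed
  define g where "g = (\<lambda>z. frechet_derivative f (at z) v)"
  \<comment> \<open>The theorem is applied to the difference of f along two parallel segments in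
    direction v; \<open>0 *\<^sub>R v\<close> and \<open>h - 0\<close> keep the literal shape of
    \<open>mvt_simple\<close>.\<close>
  have "\<exists>a\<in>{0<..<h}. (f (x + h *\<^sub>R w + h *\<^sub>R v) - f (x + h *\<^sub>R v))
      - (f (x + h *\<^sub>R w + 0 *\<^sub>R v) - f (x + 0 *\<^sub>R v))
      = (h - 0) * g (x + h *\<^sub>R w + a *\<^sub>R v) - (h - 0) * g (x + a *\<^sub>R v)"
    unfolding g_def
  proof (rule mvt_simple[OF \<open>0 < h\<close>])
    fix t
    assume t: "0 \<le> t" "t \<le> h"
    then have "x + h *\<^sub>R w + t *\<^sub>R v \<in> U" "x + t *\<^sub>R v \<in> U"
      using U[of t h] U[of t 0] \<open>0 < h\<close> by (auto simp: algebra_simps)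
    then show "((\<lambda>t. f (x + h *\<^sub>R w + t *\<^sub>R v) - f (x + t *\<^sub>R v)) has_derivative
       (\<lambda>r. r * frechet_derivative f (at (x + h *\<^sub>R w + t *\<^sub>R v)) v
         - r * frechet_derivative f (at (x + t *\<^sub>R v)) v)) (at t within {0..h})"
      by (intro has_derivative_diff lin f)
  qed
  then obtain a where a: "0 \<le> a" "a \<le> h" and
    "f (x + h *\<^sub>R w + h *\<^sub>R v) - f (x + h *\<^sub>R v) - (f (x + h *\<^sub>R w) - f x)
      = h * g (x + h *\<^sub>R w + a *\<^sub>R v) - h * g (x + a *\<^sub>R v)"
    by (fastforce dest: less_imp_le)
  then have eq: "f (x + h *\<^sub>R v + h *\<^sub>R w) - f (x + h *\<^sub>R v) - f (x + h *\<^sub>R w) + f x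
      = h * (g (x + a *\<^sub>R v + h *\<^sub>R w) - g (x + a *\<^sub>R v))"
    by (simp add: right_diff_distrib add.commute add.left_commute)
  have "\<exists>b\<in>{0<..<h}. g (x + a *\<^sub>R v + h *\<^sub>R w) - g (x + a *\<^sub>R v + 0 *\<^sub>R w)
      = (h - 0) * frechet_derivative g (at (x + a *\<^sub>R v + b *\<^sub>R w)) w"
    using a U fv by (intro mvt_simple[OF \<open>0 < h\<close>] lin) (auto simp: g_def)
  then obtain b where "0 \<le> b" "b \<le> h" "g (x + a *\<^sub>R v + h *\<^sub>R w) - g (x + a *\<^sub>R v)
      = h * frechet_derivative g (at (x + a *\<^sub>R v + b *\<^sub>R w)) w"
    by (fastforce dest: less_imp_le)
  with a eq show thesis
    by (intro that[of a b]) (auto simp: g_def power2_eq_square)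
qed

text \<open>Both orders of differentiation give the same second difference, so the two mixed
  derivatives agree at a pair of points near x. By continuity each is within half of the supposed
  gap of its value at x, which contradicts the gap.\<close>

lemma symmetric_second_derivative_real:
  fixes f :: "'a::real_normed_vector \<Rightarrow> real"
  assumes "open U" "x \<in> U" "smooth_on U f"
  shows "frechet_derivative (\<lambda>z. frechet_derivative f (at z) v) (at x) w
       = frechet_derivative (\<lambda>z. frechet_derivative f (at z) w) (at x) v"
proof (rule ccontr)
  define H where "H = (\<lambda>v w y. frechet_derivative (\<lambda>z. frechet_derivative f (at z) v) (at y) w)"
  assume "\<not> ?thesis"
  then have e: "0 < \<bar>H v w x - H w v x\<bar> / 2" (is "0 < ?e")
    by (simp add: H_def)
  have cont: "isCont (H v w) x" for v w
    unfolding H_def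
    using continuous_on_eq_continuous_at[OF assms(1)] assms(2)
      smooth_on_continuous_deriv[OF smooth_on_frechet_derivative[OF assms(3)]] by blast
  obtain d1 where d1: "d1 > 0" "\<And>y. dist y x < d1 \<Longrightarrow> dist (H v w y) (H v w x) < ?e"
    using cont[of v w] e unfolding continuous_at_eps_delta by blast
  obtain d2 where d2: "d2 > 0" "\<And>y. dist y x < d2 \<Longrightarrow> dist (H w v y) (H w v x) < ?e"
    using cont[of w v] e unfolding continuous_at_eps_delta by blast
  note d = d1 d2
  obtain d3 where d3: "d3 > 0" "ball x d3 \<subseteq> U"
    using assms openE by blast
  define d where "d = min d1 (min d2 d3)"
  \<comment> \<open>With this h every x + a v + b w with a, b in [0, h] lies within h|v| + h|w| < d
    of x; the summand 1 keeps the denominator positive and the inequality strict.\<close>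
  define h where "h = d / (1 + norm v + norm w)"
  have "d > 0"
    using d d3 by (simp add: d_def)
  then have "h > 0"
    unfolding h_def by (intro divide_pos_pos add_pos_nonneg) auto
  have near: "dist (x + a *\<^sub>R v + b *\<^sub>R w) x < d" "dist (x + a *\<^sub>R w + b *\<^sub>R v) x < d"
    if "0 \<le> a" "a \<le> h" "0 \<le> b" "b \<le> h" for a b
  proof -
    have bd: "norm (a *\<^sub>R v' + b *\<^sub>R w') \<le> h * norm v' + h * norm w'" for v' w' :: 'a
      using that by (intro norm_triangle_le add_mono) (auto intro: mult_right_mono)
    have "h * (1 + norm v + norm w) = d"
      using norm_ge_zero[of v] norm_ge_zero[of w] by (simp add: h_def del: norm_ge_zero)
    with \<open>h > 0\<close> have "h * norm v + h * norm w < d"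
      by (simp add: algebra_simps)
    with bd[of v w] bd[of w v] show "dist (x + a *\<^sub>R v + b *\<^sub>R w) x < d"
      "dist (x + a *\<^sub>R w + b *\<^sub>R v) x < d"
      by (simp_all add: dist_norm add.assoc)
  qed
  have inU: "y \<in> U" if "dist y x < d" for y
    using that d3 by (auto simp: d_def dist_commute)
  have diff: "f differentiable at y" "(\<lambda>z. frechet_derivative f (at z) u) differentiable at y"
    if "y \<in> U" for y u
    using assms that by (auto intro: smooth_on_differentiable smooth_on_frechet_derivative)
  obtain a b where ab: "0 \<le> a" "a \<le> h" "0 \<le> b" "b \<le> h"
    "f (x + h *\<^sub>R v + h *\<^sub>R w) - f (x + h *\<^sub>R v) - f (x + h *\<^sub>R w) + f x
      = h\<^sup>2 * H v w (x + a *\<^sub>R v + b *\<^sub>R w)"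
    using mixed_second_difference[of U f v h x w, OF diff \<open>h > 0\<close> inU[OF near(1)]]
    unfolding H_def by blast
  obtain a' b' where ab': "0 \<le> a'" "a' \<le> h" "0 \<le> b'" "b' \<le> h"
    "f (x + h *\<^sub>R w + h *\<^sub>R v) - f (x + h *\<^sub>R w) - f (x + h *\<^sub>R v) + f x
      = h\<^sup>2 * H w v (x + a' *\<^sub>R w + b' *\<^sub>R v)"
    using mixed_second_difference[of U f w h x v, OF diff \<open>h > 0\<close> inU[OF near(2)]]
    unfolding H_def by blast
  have swap: "x + h *\<^sub>R w + h *\<^sub>R v = x + h *\<^sub>R v + h *\<^sub>R w"
    by (simp add: algebra_simps)
  have "h\<^sup>2 * H v w (x + a *\<^sub>R v + b *\<^sub>R w) = h\<^sup>2 * H w v (x + a' *\<^sub>R w + b' *\<^sub>R v)"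
    using ab(5) ab'(5) unfolding swap by linarith
  then have "H v w (x + a *\<^sub>R v + b *\<^sub>R w) = H w v (x + a' *\<^sub>R w + b' *\<^sub>R v)"
    using \<open>h > 0\<close> by simp
  moreover have "dist (H v w (x + a *\<^sub>R v + b *\<^sub>R w)) (H v w x) < ?e"
    using near(1)[of a b] ab d by (simp add: d_def)
  moreover have "dist (H w v (x + a' *\<^sub>R w + b' *\<^sub>R v)) (H w v x) < ?e"
    using near(2)[of a' b'] ab' d by (simp add: d_def)
  ultimately have "dist (H v w x) (H w v x) < \<bar>H v w x - H w v x\<bar>"
    by (metis dist_triangle_half_r)
  then show False
    by (simp add: dist_real_def)
qed

text \<open>The mean value argument is for real values; the inner product with a basis vector
  commutes with differentiation and reduces to it.\<close>

lemma symmetric_second_derivative: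
  fixes f :: "'a::real_normed_vector \<Rightarrow> 'b::euclidean_space"
  assumes "open U" "x \<in> U" "smooth_on U f"
  shows "frechet_derivative (\<lambda>z. frechet_derivative f (at z) v) (at x) w
       = frechet_derivative (\<lambda>z. frechet_derivative f (at z) w) (at x) v"
proof (rule euclidean_eqI)
  fix b :: 'b
  have inner: "frechet_derivative (\<lambda>z. g z \<bullet> b) (at y) u = frechet_derivative g (at y) u \<bullet> b"
    if "g differentiable at y" for g :: "'a \<Rightarrow> 'b" and y u
    using frechet_derivative_at[OF has_derivative_inner_left[OF that[unfolded frechet_derivative_works]]]
    by metis
  have fb: "frechet_derivative (\<lambda>z. frechet_derivative (\<lambda>z. f z \<bullet> b) (at z) v) (at x) w
      = frechet_derivative (\<lambda>z. frechet_derivative f (at z) v) (at x) w \<bullet> b" for v w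
  proof -
    have "frechet_derivative (\<lambda>z. frechet_derivative (\<lambda>z. f z \<bullet> b) (at z) v) (at x)
        = frechet_derivative (\<lambda>z. frechet_derivative f (at z) v \<bullet> b) (at x)"
      using assms
      by (intro frechet_derivative_transform_within_open[OF _ assms(1,2)] inner)
         (auto intro: smooth_on_differentiable smooth_on_frechet_derivative smooth_on_inner_left)
    then show ?thesis
      using assms
      by (simp add: inner smooth_on_differentiable[OF smooth_on_frechet_derivative])
  qed
  show "frechet_derivative (\<lambda>z. frechet_derivative f (at z) v) (at x) w \<bullet> b
      = frechet_derivative (\<lambda>z. frechet_derivative f (at z) w) (at x) v \<bullet> b"
    using symmetric_second_derivative_real[OF assms(1,2) smooth_on_inner_left[OF assms(1,3)], of b v w]
    by (simp add: fb)
qed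

section \<open>Alternating forms\<close>

text \<open>On lists of the wrong length the form is 0, which is linear too, so no degree has to be
  tracked below.\<close>

lemma alt_forms_linear:
  assumes "\<eta> \<in> alt_forms p"
  shows "linear (\<lambda>v. \<eta> (as @ v # bs))"
proof (cases "int (length (as @ 0 # bs)) = p")
  case True
  have "\<forall>vs i. int (length vs) = p \<and> i < length vs \<longrightarrow> linear (\<lambda>v. \<eta> (vs[i := v]))"
    using assms by (simp add: alt_forms_def)
  from this[rule_format, of "as @ 0 # bs" "length as"] True show ?thesis
    by simp
next
  case False
  then have "\<eta> (as @ v # bs) = 0" for v
    using assms by (simp add: alt_forms_def)
  then show ?thesis
    by (simp add: module_hom_zero)
qed

lemma alt_forms_repeat:
  assumes "\<eta> \<in> alt_forms p"
  shows "\<eta> (as @ v # v # bs) = 0"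
proof (cases "int (length (as @ v # v # bs)) = p")
  case True
  have "\<forall>vs i j. int (length vs) = p \<and> i < j \<and> j < length vs \<and> vs ! i = vs ! j \<longrightarrow> \<eta> vs = 0"
    using assms by (simp add: alt_forms_def)
  from this[rule_format, of "as @ v # v # bs" "length as" "Suc (length as)"] True show ?thesis
    by (simp add: nth_append)
next
  case False
  then show ?thesis
    using assms by (simp add: alt_forms_def)
qed

text \<open>Polarisation: expand the form with v + w in both adjacent places, where it
  vanishes.\<close>

lemma alt_forms_swap_adjacent:
  assumes "\<eta> \<in> alt_forms p"
  shows "\<eta> (as @ v # w # bs) = - \<eta> (as @ w # v # bs)"
proof -
  have 1: "\<eta> (as @ (v + w) # u # bs) = \<eta> (as @ v # u # bs) + \<eta> (as @ w # u # bs)" for u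
    using linear_add[OF alt_forms_linear[OF assms, of as "u # bs"]] by simp
  have 2: "\<eta> (as @ u # (v + w) # bs) = \<eta> (as @ u # v # bs) + \<eta> (as @ u # w # bs)" for u
    using linear_add[OF alt_forms_linear[OF assms, of "as @ [u]" bs]] by simp
  have "\<eta> (as @ (v + w) # (v + w) # bs) = 0"
    by (rule alt_forms_repeat[OF assms])
  then show ?thesis
    by (simp add: 1 2 alt_forms_repeat[OF assms, of as v bs] alt_forms_repeat[OF assms, of as w bs])
qed

text \<open>Each entry of \<open>bs\<close> costs one adjacent transposition; entries already passed
  join the prefix.\<close>

lemma alt_forms_move:
  assumes "\<eta> \<in> alt_forms p"
  shows "\<eta> (as @ v # bs @ cs) = (-1) ^ length bs * \<eta> (as @ bs @ v # cs)"
proof (induction bs arbitrary: as)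
  case (Cons b bs)
  have "\<eta> (as @ v # (b # bs) @ cs) = - \<eta> ((as @ [b]) @ v # bs @ cs)"
    using alt_forms_swap_adjacent[OF assms, of as v b "bs @ cs"] by simp
  with Cons[of "as @ [b]"] show ?case
    by simp
qed auto

lemma alt_forms_map:
  assumes "\<eta> \<in> alt_forms p" "linear L"
  shows "(\<lambda>vs. \<eta> (map L vs)) \<in> alt_forms p"
proof -
  have "linear (\<lambda>v. \<eta> (map L (vs[i := v])))" if "int (length vs) = p" "i < length vs" for vs i
  proof -
    have "linear (\<lambda>v. \<eta> ((map L vs)[i := v]))"
      using assms(1) that by (simp add: alt_forms_def)
    from linear_compose[OF assms(2) this] show ?thesis
      by (simp add: o_def map_update)
  qed
  moreover have "\<eta> (map L vs) = 0"
    if "int (length vs) = p" "i < j" "j < length vs" "vs ! i = vs ! j" for vs i j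
  proof -
    have "\<forall>vs i j. int (length vs) = p \<and> i < j \<and> j < length vs \<and> vs ! i = vs ! j \<longrightarrow> \<eta> vs = 0"
      using assms(1) by (simp add: alt_forms_def)
    from this[rule_format, of "map L vs" i j] that show ?thesis
      by simp
  qed
  ultimately show ?thesis
    using assms(1) by (auto simp: alt_forms_def)
qed

text \<open>The cancellation behind d d = 0. A pair (i, j) means: remove entry i, then select entry
  j of what is left. Selecting the same two entries in the other order is the involution \<phi>,
  which exchanges i \<le> j with i > j and reverses the sign, so the sum equals its own
  negative.\<close>

lemma sum_faces_cancel:
  fixes g :: "nat \<Rightarrow> nat \<Rightarrow> real"
  assumes "\<And>i j. i \<le> j \<Longrightarrow> j < m \<Longrightarrow> g (Suc j) i = - g i j"
  shows "(\<Sum>i<Suc m. \<Sum>j<m. g i j) = 0"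
proof -
  let ?S = "{..<Suc m} \<times> {..<m}"
  define \<phi> :: "nat \<times> nat \<Rightarrow> nat \<times> nat"
    where "\<phi> = (\<lambda>(i, j). if i \<le> j then (Suc j, i) else (j, i - 1))"
  have "(\<Sum>z\<in>?S. case z of (i, j) \<Rightarrow> g i j) = (\<Sum>z\<in>?S. case z of (i, j) \<Rightarrow> - g i j)"
  proof (rule sum.reindex_bij_witness[of _ \<phi> \<phi>])
    fix z
    assume "z \<in> ?S"
    then obtain i j where z: "z = (i, j)" "i < Suc m" "j < m"
      by auto
    show "\<phi> (\<phi> z) = z" "\<phi> (\<phi> z) = z" "\<phi> z \<in> ?S" "\<phi> z \<in> ?S"
      using z by (auto simp: \<phi>_def)
    show "(case \<phi> z of (i, j) \<Rightarrow> - g i j) = (case z of (i, j) \<Rightarrow> g i j)"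
      using z assms[of i j] assms[of j "i - 1"] by (auto simp: \<phi>_def)
  qed
  then show ?thesis
    by (simp add: sum.cartesian_product case_prod_unfold sum_negf)
qed


section \<open>Pullback of differential forms\<close>

lemma diff_forms_alt: "\<omega> \<in> diff_forms p V \<Longrightarrow> y \<in> V \<Longrightarrow> \<omega> y \<in> alt_forms p"
  by (simp add: diff_forms_def)

lemma diff_forms_smooth: "\<omega> \<in> diff_forms p V \<Longrightarrow> smooth_on V (\<lambda>y. \<omega> y vs)"
  by (simp add: diff_forms_def)

lemma diff_forms_expansion:
  assumes "\<omega> \<in> diff_forms p V" "y \<in> V"
  shows "\<omega> y (as @ u # bs) = (\<Sum>b\<in>Basis. (u \<bullet> b) * \<omega> y (as @ b # bs))"
  using linear_euclidean_expansion[OF alt_forms_linear[OF diff_forms_alt[OF assms], of as bs], of u] by simp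

lemma diff_forms_derivative_expansion:
  assumes "open V" "\<omega> \<in> diff_forms p V" "y \<in> V"
  shows "frechet_derivative (\<lambda>z. \<omega> z (as @ u # bs)) (at y) v =
    (\<Sum>b\<in>Basis. (u \<bullet> b) * frechet_derivative (\<lambda>z. \<omega> z (as @ b # bs)) (at y) v)"
proof -
  have "((\<lambda>z. \<Sum>b\<in>Basis. (u \<bullet> b) * \<omega> z (as @ b # bs)) has_derivative
      (\<lambda>v. \<Sum>b\<in>Basis. (u \<bullet> b) * frechet_derivative (\<lambda>z. \<omega> z (as @ b # bs)) (at y) v)) (at y)"
    using diff_forms_differentiable[OF assms(2,3)]
    by (intro has_derivative_sum has_derivative_mult_right) (simp flip: frechet_derivative_works)
  then have "((\<lambda>z. \<omega> z (as @ u # bs)) has_derivative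
      (\<lambda>v. \<Sum>b\<in>Basis. (u \<bullet> b) * frechet_derivative (\<lambda>z. \<omega> z (as @ b # bs)) (at y) v)) (at y)"
    by (rule has_derivative_transform_within_open[OF _ assms(1,3)])
       (rule diff_forms_expansion[OF assms(2), symmetric])
  then show ?thesis
    by (rule fun_cong[OF frechet_derivative_at, symmetric])
qed

section \<open>Forms evaluated on varying vectors\<close>

text \<open>The last varying argument is expanded in the basis and becomes a fixed vector at the
  head of \<open>us\<close>; hence the induction from the right with \<open>us\<close>
  arbitrary.\<close>

lemma smooth_on_form_eval:
  fixes s :: "'a::euclidean_space \<Rightarrow> 'b::euclidean_space"
  assumes "open U" "s ` U \<subseteq> V" "smooth_on U s" "\<omega> \<in> diff_forms p V"
    and "\<And>l. l \<in> set ls \<Longrightarrow> smooth_on U l"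
  shows "smooth_on U (\<lambda>x. \<omega> (s x) (map (\<lambda>l. l x) ls @ us))"
  using assms(5)
proof (induction ls arbitrary: us rule: rev_induct)
  case Nil
  then show ?case
    using smooth_on_compose[OF assms(1,2) diff_forms_smooth[OF assms(4)] assms(3)] by simp
next
  case (snoc l ls)
  have "smooth_on U (\<lambda>x. \<Sum>b\<in>Basis. (l x \<bullet> b) * \<omega> (s x) (map (\<lambda>l. l x) ls @ b # us))"
    by (intro smooth_on_sum smooth_on_mult smooth_on_inner_left assms snoc) (auto intro: snoc)
  then show ?case
  proof (rule smooth_on_cong[OF assms(1), rotated])
    fix x
    assume "x \<in> U"
    then have "s x \<in> V"
      using assms(2) by auto
    from diff_forms_expansion[OF assms(4) this, of "map (\<lambda>l. l x) ls" "l x" us]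
    show "(\<Sum>b\<in>Basis. (l x \<bullet> b) * \<omega> (s x) (map (\<lambda>l. l x) ls @ b # us))
        = \<omega> (s x) (map (\<lambda>l. l x) (ls @ [l]) @ us)"
      by simp
  qed
qed

text \<open>Product rule for a multilinear expression: one term from the moving base point and one
  from each moving argument, obtained by the same peeling.\<close>

lemma has_derivative_form_eval:
  fixes s :: "'a::euclidean_space \<Rightarrow> 'b::euclidean_space"
  assumes "open U" "x \<in> U" "s ` U \<subseteq> V" "open V" "s differentiable at x" "\<omega> \<in> diff_forms p V"
    and "\<And>l. l \<in> set ls \<Longrightarrow> l differentiable at x"
  shows "((\<lambda>x. \<omega> (s x) (map (\<lambda>l. l x) ls @ us)) has_derivative
    (\<lambda>w. frechet_derivative (\<lambda>y. \<omega> y (map (\<lambda>l. l x) ls @ us)) (at (s x))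
           (frechet_derivative s (at x) w)
       + (\<Sum>j<length ls. \<omega> (s x)
           ((map (\<lambda>l. l x) ls)[j := frechet_derivative (ls ! j) (at x) w] @ us)))) (at x)"
  using assms(7)
proof (induction ls arbitrary: us rule: rev_induct)
  case Nil
  have "(\<lambda>y. \<omega> y us) differentiable at (s x)"
    using assms(2,3,6) by (auto intro: diff_forms_differentiable)
  then show ?case
    using diff_chain_at[of s _ x "\<lambda>y. \<omega> y us"] assms(5)
    by (simp add: o_def frechet_derivative_works)
next
  case (snoc l ls)
  have sx: "s x \<in> V"
    using assms(2,3) by auto
  have "l differentiable at x"
    using snoc.prems by simp
  then have l: "((\<lambda>x. l x \<bullet> b) has_derivative (\<lambda>w. frechet_derivative l (at x) w \<bullet> b)) (at x)" for b
    by (intro has_derivative_inner_left) (simp flip: frechet_derivative_works)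
  define F where "F = (\<lambda>vs. frechet_derivative (\<lambda>y. \<omega> y vs) (at (s x)))"
  define Dl :: "('a \<Rightarrow> 'b) \<Rightarrow> 'a \<Rightarrow> 'b" where "Dl = (\<lambda>l. frechet_derivative l (at x))"
  have "((\<lambda>x. \<Sum>b\<in>Basis. (l x \<bullet> b) * \<omega> (s x) (map (\<lambda>l. l x) ls @ b # us)) has_derivative
     (\<lambda>w. \<Sum>b\<in>Basis. (l x \<bullet> b) * (F (map (\<lambda>l. l x) ls @ b # us) (Dl s w)
         + (\<Sum>j<length ls. \<omega> (s x) ((map (\<lambda>l. l x) ls)[j := Dl (ls ! j) w] @ b # us)))
       + (Dl l w \<bullet> b) * \<omega> (s x) (map (\<lambda>l. l x) ls @ b # us))) (at x)"
    unfolding F_def Dl_def by (intro has_derivative_sum has_derivative_mult l snoc) (auto intro: snoc)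
  then have "((\<lambda>x. \<omega> (s x) (map (\<lambda>l. l x) (ls @ [l]) @ us)) has_derivative
     (\<lambda>w. \<Sum>b\<in>Basis. (l x \<bullet> b) * (F (map (\<lambda>l. l x) ls @ b # us) (Dl s w)
         + (\<Sum>j<length ls. \<omega> (s x) ((map (\<lambda>l. l x) ls)[j := Dl (ls ! j) w] @ b # us)))
       + (Dl l w \<bullet> b) * \<omega> (s x) (map (\<lambda>l. l x) ls @ b # us))) (at x)"
  proof (rule has_derivative_transform_within_open[OF _ assms(1,2)])
    fix y
    assume "y \<in> U"
    then have "s y \<in> V"
      using assms(3) by auto
    from diff_forms_expansion[OF assms(6) this, of "map (\<lambda>l. l y) ls" "l y" us]
    show "(\<Sum>b\<in>Basis. (l y \<bullet> b) * \<omega> (s y) (map (\<lambda>l. l y) ls @ b # us))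
        = \<omega> (s y) (map (\<lambda>l. l y) (ls @ [l]) @ us)"
      by simp
  qed
  moreover have "(\<Sum>b\<in>Basis. (l x \<bullet> b) * (F (map (\<lambda>l. l x) ls @ b # us) (Dl s w)
         + (\<Sum>j<length ls. \<omega> (s x) ((map (\<lambda>l. l x) ls)[j := Dl (ls ! j) w] @ b # us)))
       + (Dl l w \<bullet> b) * \<omega> (s x) (map (\<lambda>l. l x) ls @ b # us))
    = F (map (\<lambda>l. l x) (ls @ [l]) @ us) (Dl s w)
      + (\<Sum>j<length (ls @ [l]). \<omega> (s x) ((map (\<lambda>l. l x) (ls @ [l]))[j := Dl ((ls @ [l]) ! j) w] @ us))"
    for w
  proof -
    \<comment> \<open>The sums over the basis collapse by linearity: \<open>1\<close> for the base
      point, \<open>2\<close> for the earlier arguments, \<open>3\<close> for the derivative of the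
      last one.\<close>
    have 1: "F (map (\<lambda>l. l x) ls @ l x # us) (Dl s w)
        = (\<Sum>b\<in>Basis. (l x \<bullet> b) * F (map (\<lambda>l. l x) ls @ b # us) (Dl s w))"
      unfolding F_def by (rule diff_forms_derivative_expansion[OF assms(4,6) sx])
    have 2: "(\<Sum>j<length ls. \<omega> (s x) ((map (\<lambda>l. l x) ls)[j := Dl (ls ! j) w] @ l x # us))
        = (\<Sum>b\<in>Basis. (l x \<bullet> b) *
            (\<Sum>j<length ls. \<omega> (s x) ((map (\<lambda>l. l x) ls)[j := Dl (ls ! j) w] @ b # us)))"
      unfolding sum_distrib_left
      by (subst sum.swap) (rule sum.cong[OF refl diff_forms_expansion[OF assms(6) sx]])
    have 3: "\<omega> (s x) (map (\<lambda>l. l x) ls @ Dl l w # us)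
        = (\<Sum>b\<in>Basis. (Dl l w \<bullet> b) * \<omega> (s x) (map (\<lambda>l. l x) ls @ b # us))"
      by (rule diff_forms_expansion[OF assms(6) sx])
    have "(\<Sum>j<length (ls @ [l]). \<omega> (s x) ((map (\<lambda>l. l x) (ls @ [l]))[j := Dl ((ls @ [l]) ! j) w] @ us))
        = (\<Sum>j<length ls. \<omega> (s x) ((map (\<lambda>l. l x) ls)[j := Dl (ls ! j) w] @ l x # us))
          + \<omega> (s x) (map (\<lambda>l. l x) ls @ Dl l w # us)"
      by (simp add: nth_append list_update_append)
    then show ?thesis
      by (simp add: 1 2 3 sum.distrib distrib_left del: sum.lessThan_Suc)
  qed
  ultimately show ?case
    unfolding F_def Dl_def by (rule has_derivative_eq_rhs[OF _ ext])
qed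

text \<open>The factor s^* of \<open>pullback\<close>, separated because it alone depends on the
  point.\<close>

definition form_pullback ::
    "'a::euclidean_space set \<Rightarrow> ('a \<Rightarrow> 'b::euclidean_space) \<Rightarrow>
     ('b \<Rightarrow> 'b list \<Rightarrow> real) \<Rightarrow> 'a \<Rightarrow> 'a list \<Rightarrow> real" where
  "form_pullback U s \<omega> x vs =
     (if x \<in> U then \<omega> (s x) (map (frechet_derivative s (at x)) vs) else 0)"

lemma form_pullback_diff_forms:
  fixes s :: "'a::euclidean_space \<Rightarrow> 'b::euclidean_space"
  assumes "open U" "s ` U \<subseteq> V" "smooth_on U s" "\<omega> \<in> diff_forms p V"
  shows "form_pullback U s \<omega> \<in> diff_forms p U"
  unfolding diff_forms_def
proof (intro CollectI conjI ballI allI impI)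
  fix x
  assume x: "x \<in> U"
  then have "linear (frechet_derivative s (at x))"
    using assms(3) by (intro linear_frechet_derivative smooth_on_differentiable)
  moreover have "\<omega> (s x) \<in> alt_forms p"
    using x assms(2) by (auto intro: diff_forms_alt[OF assms(4)])
  ultimately have "(\<lambda>vs. \<omega> (s x) (map (frechet_derivative s (at x)) vs)) \<in> alt_forms p"
    by (rule alt_forms_map[rotated])
  then show "form_pullback U s \<omega> x \<in> alt_forms p"
    using x by (simp add: form_pullback_def[abs_def])
next
  fix x
  assume "x \<notin> U"
  then show "form_pullback U s \<omega> x = 0"
    by (simp add: form_pullback_def fun_eq_iff)
next
  fix vs
  \<comment> \<open>The pushed-forward vectors are written as functions of the point, with no fixed
    vectors left over.\<close>
  have "smooth_on U (\<lambda>x. \<omega> (s x)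
      (map (\<lambda>l. l x) (map (\<lambda>v y. frechet_derivative s (at y) v) vs) @ []))"
    using assms by (intro smooth_on_form_eval[OF assms]) (auto intro: smooth_on_frechet_derivative)
  then show "smooth_on U (\<lambda>x. form_pullback U s \<omega> x vs)"
    by (rule smooth_on_cong[OF assms(1), rotated]) (simp add: form_pullback_def o_def)
qed

text \<open>Of the two summands the first builds the pullback of D \<omega>; the second is the error
  term that has to disappear after alternating summation.\<close>

lemma frechet_derivative_form_pullback:
  fixes s :: "'a::euclidean_space \<Rightarrow> 'b::euclidean_space"
  assumes "open U" "x \<in> U" "s ` U \<subseteq> V" "open V" "smooth_on U s" "\<omega> \<in> diff_forms p V"
  shows "frechet_derivative (\<lambda>y. form_pullback U s \<omega> y us) (at x) w
    = frechet_derivative (\<lambda>y. \<omega> y (map (frechet_derivative s (at x)) us)) (at (s x))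
        (frechet_derivative s (at x) w)
      + (\<Sum>j<length us. \<omega> (s x) ((map (frechet_derivative s (at x)) us)
           [j := frechet_derivative (\<lambda>y. frechet_derivative s (at y) (us ! j)) (at x) w]))"
proof -
  let ?ls = "map (\<lambda>v y. frechet_derivative s (at y) v) us"
  have "((\<lambda>x. \<omega> (s x) (map (\<lambda>l. l x) ?ls @ [])) has_derivative
    (\<lambda>w. frechet_derivative (\<lambda>y. \<omega> y (map (\<lambda>l. l x) ?ls @ [])) (at (s x))
           (frechet_derivative s (at x) w)
       + (\<Sum>j<length ?ls. \<omega> (s x)
           ((map (\<lambda>l. l x) ?ls)[j := frechet_derivative (?ls ! j) (at x) w] @ [])))) (at x)"
    using assms
    by (intro has_derivative_form_eval[OF assms(1-4) _ assms(6)])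
       (auto intro: smooth_on_differentiable smooth_on_frechet_derivative)
  then have "((\<lambda>x. form_pullback U s \<omega> x us) has_derivative
    (\<lambda>w. frechet_derivative (\<lambda>y. \<omega> y (map (\<lambda>l. l x) ?ls @ [])) (at (s x))
           (frechet_derivative s (at x) w)
       + (\<Sum>j<length ?ls. \<omega> (s x)
           ((map (\<lambda>l. l x) ?ls)[j := frechet_derivative (?ls ! j) (at x) w] @ [])))) (at x)"
    by (rule has_derivative_transform_within_open[OF _ assms(1,2)])
       (simp add: form_pullback_def o_def)
  from fun_cong[OF frechet_derivative_at[OF this, symmetric], of w] show ?thesis
    by (simp add: o_def)
qed

text \<open>
  The second derivatives of \<open>s\<close> produced by the product rule cancel in pairs, since they are
  symmetric while the form is alternating.
\<close>

lemma ext_deriv_form_pullback: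
  fixes s :: "'a::euclidean_space \<Rightarrow> 'b::euclidean_space"
  assumes "open U" "s ` U \<subseteq> V" "open V" "smooth_on U s" "\<omega> \<in> diff_forms p V"
  shows "ext_deriv U (form_pullback U s \<omega>) = form_pullback U s (ext_deriv V \<omega>)"
proof (intro ext)
  fix x vs
  show "ext_deriv U (form_pullback U s \<omega>) x vs = form_pullback U s (ext_deriv V \<omega>) x vs"
  proof (cases "x \<in> U")
    case x: True
    define D where "D = frechet_derivative s (at x)"
    define H where "H = (\<lambda>v. frechet_derivative (\<lambda>y. frechet_derivative s (at y) v) (at x))"
    define rm where "rm = (\<lambda>i. take i vs @ drop (Suc i) vs)"
    \<comment> \<open>In \<open>T i j\<close>, i is the removed vector, along which one
      differentiates, and j is the place in the shortened list whose entry ds(v) is replaced by a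
      second derivative.\<close>
    define T where "T = (\<lambda>i j. (-1) ^ i * \<omega> (s x) ((map D (rm i))[j := H (rm i ! j) (vs ! i)]))"
    have alt: "\<omega> (s x) \<in> alt_forms p"
      using x assms(2) by (auto intro: diff_forms_alt[OF assms(5)])
    have zero: "(\<Sum>i<length vs. \<Sum>j<length (rm i). T i j) = 0"
    proof (cases vs)
      case (Cons v vs')
      have len: "length (rm i) = length vs'" if "i < length vs" for i
        using that Cons by (simp add: rm_def)
      have "(\<Sum>i<Suc (length vs'). \<Sum>j<length vs'. T i j) = 0"
      proof (rule sum_faces_cancel)
        fix i j
        assume ij: "i \<le> j" "j < length vs'"
        \<comment> \<open>For i \<le> j, entry j of the list without entry i is entry
          \<open>Suc j\<close> of \<open>vs\<close>; a and b are the two vectors that enter the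
          second derivative.\<close>
        define as a where "as = take i vs" and "a = vs ! i"
        define bs b where "bs = take (j - i) (drop (Suc i) vs)" and "b = vs ! Suc j"
        define cs where "cs = drop (Suc (Suc j)) vs"
        have i: "vs = as @ a # drop (Suc i) vs"
          unfolding as_def a_def using ij Cons by (intro id_take_nth_drop) simp
        have "drop (Suc i) vs = bs @ drop (j - i) (drop (Suc i) vs)"
          by (simp only: bs_def append_take_drop_id)
        also have "drop (j - i) (drop (Suc i) vs) = drop (Suc j) vs"
          using ij by simp
        also have "\<dots> = b # cs"
          using ij Cons Cons_nth_drop_Suc[of "Suc j" vs] by (simp add: b_def cs_def)
        finally have vs: "vs = as @ a # bs @ b # cs"
          using i by simp
        have l: "length as = i" "length bs = j - i"
          using ij Cons by (simp_all add: as_def bs_def)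
        have rm_i: "rm i = as @ bs @ b # cs" and rm_j: "rm (Suc j) = as @ a # bs @ cs"
          using ij l unfolding rm_def vs by (simp_all add: Suc_diff_le)
        have nth: "vs ! i = a" "vs ! Suc j = b"
          by (simp_all add: a_def b_def)
        have "T i j = (-1) ^ i * \<omega> (s x) (map D as @ map D bs @ H b a # map D cs)"
          using ij l unfolding T_def rm_i nth by (simp add: nth_append list_update_append)
        moreover have "T (Suc j) i = (-1) ^ Suc j * \<omega> (s x) (map D as @ H a b # map D bs @ map D cs)"
          using ij l unfolding T_def rm_j nth by (simp add: nth_append list_update_append)
        moreover have "H a b = H b a"
          unfolding H_def by (rule symmetric_second_derivative[OF assms(1) x assms(4)])
        \<comment> \<open>Carrying the second derivative past \<open>bs\<close> costs (-1)^(j - i),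
          which turns the prefactor (-1)^(Suc j) into -(-1)^i.\<close>
        moreover have "(-1::real) ^ j * (-1) ^ (j - i) = (-1) ^ i"
          using ij by (metis le_add_diff_inverse minus_one_power_iff power_add even_add)
        ultimately show "T (Suc j) i = - T i j"
          using alt_forms_move[OF alt, of "map D as" "H b a" "map D bs" "map D cs"] l
          by simp
      qed
      with len Cons show ?thesis
        by simp
    qed simp
    have "ext_deriv U (form_pullback U s \<omega>) x vs
      = (\<Sum>i<length vs. (-1) ^ i * frechet_derivative (\<lambda>y. \<omega> y (map D (rm i))) (at (s x)) (D (vs ! i)))
        + (\<Sum>i<length vs. \<Sum>j<length (rm i). T i j)"
      using x unfolding ext_deriv_def T_def D_def H_def rm_def
      by (simp add: frechet_derivative_form_pullback[OF assms(1) x assms(2-5)]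
          distrib_left sum.distrib sum_distrib_left)
    then show ?thesis
      using x assms(2) zero
      by (auto simp: form_pullback_def ext_deriv_def D_def rm_def take_map drop_map)
  qed (simp add: ext_deriv_def form_pullback_def)
qed


section \<open>Pullback of superforms\<close>

lemma pullback_sum_form_tensor:
  "pullback U (s, L) (\<Sum>i<n::nat. form_tensor (\<omega> i) (\<eta> i)) =
    (\<Sum>i<n. form_tensor (form_pullback U s (\<omega> i)) (\<lambda>ws. \<eta> i (map L ws)))"
  by (simp add: pullback_def form_pullback_def form_tensor_def sum_fun_apply fun_eq_iff)

lemma pullback_superforms:
  assumes "open U" "s ` U \<subseteq> V" "smooth_on U s" "linear L" "\<alpha> \<in> superforms p q V"
  shows "pullback U (s, L) \<alpha> \<in> superforms p q U"
proof -
  obtain n :: nat and \<omega> \<eta> where \<alpha>: "\<alpha> = (\<Sum>i<n. form_tensor (\<omega> i) (\<eta> i))"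
    and "\<forall>i<n. \<omega> i \<in> diff_forms p V \<and> \<eta> i \<in> alt_forms q"
    using assms(5) unfolding superforms_def by blast
  then have "\<forall>i<n. form_pullback U s (\<omega> i) \<in> diff_forms p U \<and>
      (\<lambda>ws. \<eta> i (map L ws)) \<in> alt_forms q"
    using form_pullback_diff_forms[OF assms(1-3)] alt_forms_map[OF _ assms(4)] by blast
  then show ?thesis
    unfolding superforms_def \<alpha> pullback_sum_form_tensor
    by (intro CollectI exI, rule conjI[OF refl])
qed

text \<open>On each elementary tensor the factor pulled back by L is constant in the point, so the
  identity for ordinary forms applies termwise.\<close>

lemma d'_pullback:
  assumes "open U" "s ` U \<subseteq> V" "open V" "smooth_on U s" "\<alpha> \<in> superforms p q V"
  shows "d' U (pullback U (s, L) \<alpha>) = pullback U (s, L) (d' V \<alpha>)"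
proof -
  obtain n :: nat and \<omega> \<eta> where \<alpha>: "\<alpha> = (\<Sum>i<n. form_tensor (\<omega> i) (\<eta> i))"
    and \<omega>: "\<forall>i<n. \<omega> i \<in> diff_forms p V"
    using assms(5) unfolding superforms_def by blast
  have "\<forall>i<n. form_pullback U s (\<omega> i) \<in> diff_forms p U"
    using \<omega> form_pullback_diff_forms[OF assms(1,2,4)] by blast
  then have "d' U (pullback U (s, L) \<alpha>)
      = (\<Sum>i<n. form_tensor (ext_deriv U (form_pullback U s (\<omega> i))) (\<lambda>ws. \<eta> i (map L ws)))"
    unfolding \<alpha> pullback_sum_form_tensor by (rule d'_sum_form_tensor)
  also have "\<dots> = (\<Sum>i<n. form_tensor (form_pullback U s (ext_deriv V (\<omega> i))) (\<lambda>ws. \<eta> i (map L ws)))"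
    using \<omega> ext_deriv_form_pullback[OF assms(1-4)] by (intro sum.cong) auto
  also have "\<dots> = pullback U (s, L) (d' V \<alpha>)"
    unfolding \<alpha> d'_sum_form_tensor[OF \<omega>] pullback_sum_form_tensor ..
  finally show ?thesis .
qed

text \<open>Equality of superforms is equality of functions on the whole space. Pullback cuts off by
  0 outside U, so the identity pair returns \<alpha> because \<alpha> vanishes there as
  well.\<close>

lemma superforms_outside:
  assumes "\<alpha> \<in> superforms p q U" "x \<notin> U"
  shows "\<alpha> x vs ws = 0"
proof -
  obtain n :: nat and \<omega> \<eta> where "\<alpha> = (\<Sum>i<n. form_tensor (\<omega> i) (\<eta> i))"
    and "\<forall>i<n. \<omega> i \<in> diff_forms p U"
    using assms(1) unfolding superforms_def by blast
  with assms(2) show ?thesis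
    by (simp add: sum_fun_apply form_tensor_def diff_forms_def)
qed

text \<open>The slices of s_G are known on V only; openness of V makes their derivatives agree as
  well.\<close>

lemma pullback_cong:
  assumes "open U" "\<And>x. x \<in> U \<Longrightarrow> s x = t x" "\<And>x. x \<in> U \<Longrightarrow> t differentiable at x"
  shows "pullback U (s, L) \<alpha> = pullback U (t, L) \<alpha>"
proof -
  have "frechet_derivative s (at x) = frechet_derivative t (at x)" if "x \<in> U" for x
    using frechet_derivative_transform_within_open[OF assms(3) assms(1)] assms(2) that by metis
  with assms(2) show ?thesis
    by (intro ext) (simp add: pullback_def)
qed

lemma pullback_id:
  assumes "\<alpha> \<in> superforms p q U"
  shows "pullback U (\<lambda>x. x, id) \<alpha> = \<alpha>"
  using superforms_outside[OF assms] by (simp add: pullback_def fun_eq_iff)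

text \<open>Chain rule along x |-> (x, t), whose derivative is v |-> (v, 0). For t in [0,1] the
  point (x, t) lies in the slab, so the restriction keeps the value.\<close>

lemma face_pullback_restrict_slab_pullback:
  fixes s :: "'a::euclidean_space \<times> real \<Rightarrow> 'b::euclidean_space"
  assumes "smooth_on (V \<times> UNIV) s" "t \<in> {0..1}"
  shows "face_pullback t V (restrict_slab V (pullback (V \<times> UNIV) (s, L) \<alpha>))
    = pullback V (\<lambda>x. s (x, t), \<lambda>w. L (w, 0)) \<alpha>"
proof -
  have "frechet_derivative (\<lambda>x. s (x, t)) (at x) = (\<lambda>v. frechet_derivative s (at (x, t)) (v, 0))"
    if "x \<in> V" for x
  proof -
    have "((\<lambda>x. (x, t)) has_derivative (\<lambda>v. (v, 0))) (at x)"
      by (intro has_derivative_Pair has_derivative_ident has_derivative_const)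
    moreover have "(s has_derivative frechet_derivative s (at (x, t))) (at (x, t))"
      using smooth_on_differentiable[OF assms(1)] that by (simp flip: frechet_derivative_works)
    ultimately show ?thesis
      using diff_chain_at[of "\<lambda>x. (x, t)" _ x s] frechet_derivative_at by (fastforce simp: o_def)
  qed
  then show ?thesis
    using assms(2)
    by (intro ext) (simp add: face_pullback_def restrict_slab_def pullback_def slab_def o_def)
qed

section \<open>The homotopy formula\<close>

theorem theorem2p12:
  fixes V :: "(real ^ 'r) set"
    and s_F :: "real ^ 'r \<Rightarrow> real ^ 'r"
    and s_G :: "(real ^ 'r) \<times> real \<Rightarrow> real ^ 'r"
    and K' :: "int \<Rightarrow> int \<Rightarrow> ((real ^ 'r) \<times> real) superform \<Rightarrow> (real ^ 'r) superform"
    and p q :: int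
    and \<alpha> :: "(real ^ 'r) superform"
  assumes "open V"
    and "smooth_on V s_F" and "s_F ` V \<subseteq> V"
    and "smooth_on (V \<times> UNIV) s_G" and "s_G ` (V \<times> UNIV) \<subseteq> V"
    and "\<And>x. x \<in> V \<Longrightarrow> s_G (x, 0) = s_F x"
    and "\<And>x. x \<in> V \<Longrightarrow> s_G (x, 1) = x"
    and "\<And>p q. linear_operator (slab_superforms p q V) (superforms (p - 1) q V) (K' p q)"
    and "\<And>p q \<beta>. \<beta> \<in> slab_superforms p q V \<Longrightarrow>
           d' V (K' p q \<beta>) + K' (p + 1) q (slab_d' V \<beta>)
             = face_pullback 1 V \<beta> - face_pullback 0 V \<beta>"
    and "\<alpha> \<in> superforms p q V"
  shows "\<alpha> - pullback V (s_F, id) \<alpha>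
           = d' V (K' p q (restrict_slab V (pullback (V \<times> UNIV) (s_G, fst) \<alpha>)))
             + K' (p + 1) q (restrict_slab V (pullback (V \<times> UNIV) (s_G, fst) (d' V \<alpha>)))"
proof -
  let ?W = "V \<times> (UNIV :: real set)"
  let ?\<gamma> = "pullback ?W (s_G, fst) \<alpha>"
  have W: "open ?W" "slab_nbhd V ?W"
    using \<open>open V\<close> by (auto simp: slab_nbhd_def slab_def intro: open_Times)
  have \<gamma>: "?\<gamma> \<in> superforms p q ?W"
    by (rule pullback_superforms[OF W(1) assms(5,4) linear_fst assms(10)])
  then have \<beta>: "restrict_slab V ?\<gamma> \<in> slab_superforms p q V"
    unfolding slab_superforms_def using W(2) by blast
  \<comment> \<open>The slab operator may be computed on the representative over V x R, where
    pullback commutes with \<open>d'\<close>; this turns K'd'G^* into K'G^*d'.\<close>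
  have d: "slab_d' V (restrict_slab V ?\<gamma>) = restrict_slab V (pullback ?W (s_G, fst) (d' V \<alpha>))"
    using slab_d'_restrict_slab[OF assms(1) W(2) \<gamma>] d'_pullback[OF W(1) assms(5,1,4,10)] by metis
  \<comment> \<open>On both faces the second map becomes w |-> \<open>fst (w, 0)\<close>, which is
    \<open>id\<close> and so matches L_F.\<close>
  have face: "face_pullback t V (restrict_slab V ?\<gamma>) = pullback V (\<lambda>x. s_G (x, t), id) \<alpha>"
    if "t \<in> {0..1}" for t
    using face_pullback_restrict_slab_pullback[OF assms(4) that, of fst \<alpha>] by (simp add: id_def)
  have "face_pullback 1 V (restrict_slab V ?\<gamma>) = \<alpha>"
    using pullback_cong[OF assms(1,7), where L = id and \<alpha> = \<alpha>] pullback_id[OF assms(10)] by (simp add: face)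
  moreover have "face_pullback 0 V (restrict_slab V ?\<gamma>) = pullback V (s_F, id) \<alpha>"
    using pullback_cong[OF assms(1,6) smooth_on_differentiable[OF assms(2)], where L = id and \<alpha> = \<alpha>]
    by (simp add: face)
  ultimately show ?thesis
    using assms(9)[OF \<beta>] by (simp add: d)
qed

end
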